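(* Assume that the MPSC-tailored strong second-order constraint qualification (MPSC-SSOCQ) holds at $\bar{x}\in\mathcal{F}$. Then the MPSC Abadie constraint qualification (MPSC-ACQ) holds at $\bar{x}$, i.e. $\mathcal{L}^{MPSC}_{\mathcal{F}}(\bar{x})=\mathcal{T}_{\mathcal{F}}(\bar{x})$.
   Context: (MPSC) is the problem: minimize $f(x)$ over $x\in\mathbb{R}^n$ subject to $g_i(x)\le 0$ ($i=1,\dots,m$), $h_j(x)=0$ ($j=1,\dots,p$), $G_k(x)H_k(x)=0$ ($k=1,\dots,l$), where $f,g_i,h_j,G_k,H_k:\mathbb{R}^n\to\mathbb{R}$ are twice continuously differentiable. $\mathcal{F}$ denotes its feasible set. For a feasible point $\bar{x}$: $\mathcal{I}_h=\{1,\dots,p\}$, $\mathcal{I}_g=\{i: g_i(\bar{x})=0\}$, $\mathcal{I}_G=\{k: G_k(\bar{x})=0,\,H_k(\bar{x})\neq0\}$, $\mathcal{I}_H=\{k: G_k(\bar{x})\ne0,\,H_k(\bar{x})=0\}$, $\mathcal{I}_{GH}=\{k: G_k(\bar{x})=H_k(\bar{x})=0\}$. Tangent cone: $\mathcal{T}_{\mathcal{F}}(\bar{x})=\{d\in\mathbb{R}^n:\exists\,t_k\ge0,\ x^k\in\mathcal{F},\ x^k\to\bar{x}\text{ with }t_k(x^k-\bar{x})\to d\}$. Linearization cone: $\mathcal{L}^{MPSC}_{\mathcal{F}}(\bar{x})$ is the set of $d\in\mathbb{R}^n$ with $\nabla g_i(\bar{x})^\top d\le0$ ($i\in\mathcal{I}_g$),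 $\nabla h_j(\bar{x})^\top d=0$ ($j\in\mathcal{I}_h$), $\nabla G_k(\bar{x})^\top d=0$ ($k\in\mathcal{I}_G$), $\nabla H_k(\bar{x})^\top d=0$ ($k\in\mathcal{I}_H$), $(\nabla G_k(\bar{x})^\top d)(\nabla H_k(\bar{x})^\top d)=0$ ($k\in\mathcal{I}_{GH}$). MPSC-SSOCQ holds at $\bar{x}$ if for every nonzero $d\in\mathcal{L}^{MPSC}_{\mathcal{F}}(\bar{x})$ there exist $\delta>0$, sets $\mathcal{J},\mathcal{K}\subseteq\mathcal{I}_{GH}$ and a twice differentiable arc $\xi:[0,\delta)\to\mathbb{R}^n$ such that $\xi(t)\in\mathcal{F}$ for all $t\in[0,\delta)$; $\xi(0)=\bar{x}$ and $\xi'_+(0)=d$ (right derivative); and for all $t\in[0,\delta)$: $g_i(\xi(t))=0$ for $i\in\mathcal{I}:=\{i\in\mathcal{I}_g:\nabla g_i(\bar{x})^\top d=0\}$, $G_k(\xi(t))=0$ for $k\in\mathcal{I}_G\cup\mathcal{J}$, $H_k(\xi(t))=0$ for $k\in\mathcal{I}_H\cup\mathcal{K}$. *)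

theory Defs
  imports "HOL-Analysis.Analysis"
begin

definition C2_function :: "('a::real_normed_vector \<Rightarrow> real) \<Rightarrow> bool" where
  "C2_function f \<longleftrightarrow>
    (\<exists>(f' :: 'a \<Rightarrow> 'a \<Rightarrow>\<^sub>L real) (f'' :: 'a \<Rightarrow> 'a \<Rightarrow>\<^sub>L ('a \<Rightarrow>\<^sub>L real)).
       (\<forall>x. (f has_derivative blinfun_apply (f' x)) (at x)) \<and>
       (\<forall>x. (f' has_derivative blinfun_apply (f'' x)) (at x)) \<and>
       continuous_on UNIV f'')"

definition gradient :: "('a::real_inner \<Rightarrow> real) \<Rightarrow> 'a \<Rightarrow> 'a" where
  "gradient f x = (THE D. GDERIV f x :> D)"

lemma gradient_eqI:
  assumes "GDERIV f x :> D"
  shows "gradient f x = D"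
  unfolding gradient_def
proof (rule the_equality[where P = "\<lambda>D. GDERIV f x :> D"])
  fix E assume "GDERIV f x :> E"
  with assms have "(\<lambda>h. h \<bullet> E) = (\<lambda>h. h \<bullet> D)"
    unfolding gderiv_def by (metis has_derivative_unique)
  then show "E = D"
    by (metis inner_commute vector_eq_rdot)
qed (fact assms)

lemma C2_function_GDERIV_gradient:
  fixes f :: "'a::euclidean_space \<Rightarrow> real"
  assumes "C2_function f"
  shows "GDERIV f x :> gradient f x"
proof -
  obtain f' :: "'a \<Rightarrow> 'a \<Rightarrow>\<^sub>L real" where f': "(f has_derivative blinfun_apply (f' x)) (at x)"
    using assms unfolding C2_function_def by blast
  have "linear (blinfun_apply (f' x))"
    by (rule bounded_linear.linear) (rule blinfun.bounded_linear_right)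
  then have "blinfun_apply (f' x) = (\<lambda>h. h \<bullet> adjoint (blinfun_apply (f' x)) 1)"
    by (simp add: adjoint_works fun_eq_iff)
  with f' have "GDERIV f x :> adjoint (blinfun_apply (f' x)) 1"
    by (simp add: gderiv_def)
  then show ?thesis
    using gradient_eqI by metis
qed

(* One-sided derivatives are meant at those end points of the interval S that belong to S. *)
definition twice_differentiable_arc_on ::
  "(real \<Rightarrow> 'a::real_normed_vector) \<Rightarrow> real set \<Rightarrow> bool" where
  "twice_differentiable_arc_on \<xi> S \<longleftrightarrow>
    (\<exists>\<xi>' \<xi>''. \<forall>t\<in>S. (\<xi> has_vector_derivative \<xi>' t) (at t within S) \<and>
                  (\<xi>' has_vector_derivative \<xi>'' t) (at t within S))"

(* Minimize objective x subject to g i x <= 0 (i = 1..m), h j x = 0 (j = 1..p) and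
   G k x * H k x = 0 (k = 1..l).  The values of the families at indices outside these
   ranges are irrelevant. *)
record ('n::finite) mpsc =
  objective :: "real ^ 'n \<Rightarrow> real"
  num_ineq :: nat
  num_eq :: nat
  num_switch :: nat
  ineq_con :: "nat \<Rightarrow> real ^ 'n \<Rightarrow> real"
  eq_con :: "nat \<Rightarrow> real ^ 'n \<Rightarrow> real"
  switch_G :: "nat \<Rightarrow> real ^ 'n \<Rightarrow> real"
  switch_H :: "nat \<Rightarrow> real ^ 'n \<Rightarrow> real"

definition C2_mpsc :: "'n::finite mpsc \<Rightarrow> bool" where
  "C2_mpsc P \<longleftrightarrow>
     C2_function (objective P) \<and>
     (\<forall>i\<in>{1..num_ineq P}. C2_function (ineq_con P i)) \<and>
     (\<forall>j\<in>{1..num_eq P}. C2_function (eq_con P j)) \<and>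
     (\<forall>k\<in>{1..num_switch P}. C2_function (switch_G P k) \<and> C2_function (switch_H P k))"

definition feasible_set :: "'n::finite mpsc \<Rightarrow> (real ^ 'n) set" where
  "feasible_set P =
     {x. (\<forall>i\<in>{1..num_ineq P}. ineq_con P i x \<le> 0) \<and>
         (\<forall>j\<in>{1..num_eq P}. eq_con P j x = 0) \<and>
         (\<forall>k\<in>{1..num_switch P}. switch_G P k x * switch_H P k x = 0)}"

definition I_h :: "'n::finite mpsc \<Rightarrow> nat set" where
  "I_h P = {1..num_eq P}"

definition I_g :: "'n::finite mpsc \<Rightarrow> real ^ 'n \<Rightarrow> nat set" where
  "I_g P xbar = {i\<in>{1..num_ineq P}. ineq_con P i xbar = 0}"

definition I_G :: "'n::finite mpsc \<Rightarrow> real ^ 'n \<Rightarrow> nat set" where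
  "I_G P xbar = {k\<in>{1..num_switch P}. switch_G P k xbar = 0 \<and> switch_H P k xbar \<noteq> 0}"

definition I_H :: "'n::finite mpsc \<Rightarrow> real ^ 'n \<Rightarrow> nat set" where
  "I_H P xbar = {k\<in>{1..num_switch P}. switch_G P k xbar \<noteq> 0 \<and> switch_H P k xbar = 0}"

definition I_GH :: "'n::finite mpsc \<Rightarrow> real ^ 'n \<Rightarrow> nat set" where
  "I_GH P xbar = {k\<in>{1..num_switch P}. switch_G P k xbar = 0 \<and> switch_H P k xbar = 0}"

definition tangent_cone :: "'a::real_normed_vector set \<Rightarrow> 'a \<Rightarrow> 'a set" where
  "tangent_cone F xbar =
     {d. \<exists>(t :: nat \<Rightarrow> real) (x :: nat \<Rightarrow> 'a).
           (\<forall>k. t k \<ge> 0) \<and> (\<forall>k. x k \<in> F) \<and> x \<longlonglongrightarrow> xbar \<and>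
           (\<lambda>k. t k *\<^sub>R (x k - xbar)) \<longlonglongrightarrow> d}"

definition mpsc_linearization_cone :: "'n::finite mpsc \<Rightarrow> real ^ 'n \<Rightarrow> (real ^ 'n) set" where
  "mpsc_linearization_cone P xbar =
     {d. (\<forall>i\<in>I_g P xbar. gradient (ineq_con P i) xbar \<bullet> d \<le> 0) \<and>
         (\<forall>j\<in>I_h P. gradient (eq_con P j) xbar \<bullet> d = 0) \<and>
         (\<forall>k\<in>I_G P xbar. gradient (switch_G P k) xbar \<bullet> d = 0) \<and>
         (\<forall>k\<in>I_H P xbar. gradient (switch_H P k) xbar \<bullet> d = 0) \<and>
         (\<forall>k\<in>I_GH P xbar.
            (gradient (switch_G P k) xbar \<bullet> d) * (gradient (switch_H P k) xbar \<bullet> d) = 0)}"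

definition MPSC_SSOCQ :: "'n::finite mpsc \<Rightarrow> real ^ 'n \<Rightarrow> bool" where
  "MPSC_SSOCQ P xbar \<longleftrightarrow>
     (\<forall>d\<in>mpsc_linearization_cone P xbar. d \<noteq> 0 \<longrightarrow>
       (\<exists>\<delta>>0. \<exists>J K. \<exists>\<xi> :: real \<Rightarrow> real ^ 'n.
          J \<subseteq> I_GH P xbar \<and> K \<subseteq> I_GH P xbar \<and>
          twice_differentiable_arc_on \<xi> {0..<\<delta>} \<and>
          (\<forall>t\<in>{0..<\<delta>}. \<xi> t \<in> feasible_set P) \<and>
          \<xi> 0 = xbar \<and>
          (\<xi> has_vector_derivative d) (at_right 0) \<and>
          (\<forall>t\<in>{0..<\<delta>}.
             (\<forall>i\<in>{i\<in>I_g P xbar. gradient (ineq_con P i) xbar \<bullet> d = 0}. ineq_con P i (\<xi> t) = 0) \<and>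
             (\<forall>k\<in>I_G P xbar \<union> J. switch_G P k (\<xi> t) = 0) \<and>
             (\<forall>k\<in>I_H P xbar \<union> K. switch_H P k (\<xi> t) = 0))))"

definition MPSC_ACQ :: "'n::finite mpsc \<Rightarrow> real ^ 'n \<Rightarrow> bool" where
  "MPSC_ACQ P xbar \<longleftrightarrow>
     mpsc_linearization_cone P xbar = tangent_cone (feasible_set P) xbar"

end

theory Submission
  imports Defs "HOL-Real_Asymp.Real_Asymp"
begin

text \<open>
  Each inclusion transfers a limit of difference quotients through a derivative, and both
  transfers are instances of the sequential chain rule \<open>has_derivative_scaled_sequence\<close>.

  \<^item> \<^emph>\<open>Tangent directions are linearized feasible directions.\<close>  If \<open>t\<^sub>k (x\<^sub>k - xbar) \<longlonglongrightarrow> d\<close> along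
    feasible \<open>x\<^sub>k\<close>, then \<open>t\<^sub>k (f x\<^sub>k - f xbar) \<longlonglongrightarrow> \<nabla>f(xbar) \<bullet> d\<close> for every constraint function \<open>f\<close>,
    and the sign of the left-hand side is known from feasibility.  A switching constraint is used
    in two ways.  Its product \<open>G\<^sub>k H\<^sub>k\<close> is itself an equality constraint, whose gradient at \<open>xbar\<close> is
    a nonzero multiple of the gradient of the one factor that vanishes there.  If both factors vanish,
    this gradient is zero and carries no information; then the product of the two scaled factors,
    \<open>(t\<^sub>k G x\<^sub>k) (t\<^sub>k H x\<^sub>k) = 0\<close>, is passed to the limit instead.

  \<^item> \<^emph>\<open>Linearized feasible directions are tangent.\<close>  The constraint qualification attaches to each
    \<open>d \<noteq> 0\<close> a feasible arc with initial velocity \<open>d\<close>, and sampling the arc at times tending to \<open>0\<close>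
    shows that \<open>d\<close> is tangent.
\<close>

text \<open>
  Since the \<open>t k\<close> may be unbounded, continuity alone is not enough: the remainder of the first-order
  expansion is \<open>norm (x k - a)\<close> times a factor tending to \<open>0\<close>, so that scaling it by \<open>t k\<close> leaves
  a bounded quantity times that factor.
\<close>

lemma has_derivative_scaled_sequence:
  fixes f :: "'a::real_normed_vector \<Rightarrow> 'b::real_normed_vector"
  assumes deriv: "(f has_derivative f') (at a within S)"
    and x_in: "\<And>k. x k \<in> S"
    and x_lim: "x \<longlonglongrightarrow> a"
    and tx_lim: "(\<lambda>k. t k *\<^sub>R (x k - a)) \<longlonglongrightarrow> d"
  shows "(\<lambda>k. t k *\<^sub>R (f (x k) - f a)) \<longlonglongrightarrow> f' d"
proof -
  define r where "r y = norm (f y - f a - f' (y - a)) / norm (y - a)" for y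
  interpret f': bounded_linear f'
    using deriv by (rule has_derivative_bounded_linear)
  \<comment> \<open>The sequence may take the value \<open>a\<close>, where \<open>r\<close> has the default value \<open>0\<close> of a division by
      zero; this is exactly the value that makes \<open>r\<close> continuous.\<close>
  have "(r \<longlongrightarrow> 0) (at a within S)"
    using deriv unfolding has_derivative_iff_norm r_def by blast
  then have "continuous (at a within S) r"
    by (simp add: continuous_within r_def)
  then have "(\<lambda>k. r (x k)) \<longlonglongrightarrow> r a"
    by (rule continuous_within_tendsto_compose) (use x_in x_lim in auto)
  then have "(\<lambda>k. norm (t k *\<^sub>R (x k - a)) * r (x k)) \<longlonglongrightarrow> norm d * 0"
    using tx_lim by (intro tendsto_intros) (auto simp: r_def)
  moreover have "norm (t k *\<^sub>R (x k - a)) * r (x k)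
      = norm (t k *\<^sub>R (f (x k) - f a - f' (x k - a)))" for k
    by (cases "x k = a") (simp_all add: r_def f'.zero)
  ultimately have "(\<lambda>k. norm (t k *\<^sub>R (f (x k) - f a - f' (x k - a)))) \<longlonglongrightarrow> 0"
    by (simp only: mult_zero_right)
  then have rem: "(\<lambda>k. t k *\<^sub>R (f (x k) - f a - f' (x k - a))) \<longlonglongrightarrow> 0"
    by (rule tendsto_norm_zero_cancel)
  have "(\<lambda>k. f' (t k *\<^sub>R (x k - a)) + t k *\<^sub>R (f (x k) - f a - f' (x k - a))) \<longlonglongrightarrow> f' d + 0"
    using f'.tendsto[OF tx_lim] rem by (rule tendsto_add)
  then show ?thesis
    by (simp add: f'.scaleR flip: scaleR_add_right)
qed

lemma GDERIV_scaled_sequence: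
  fixes f :: "'a::real_inner \<Rightarrow> real"
  assumes "GDERIV f a :> D"
    and "x \<longlonglongrightarrow> a"
    and "(\<lambda>k. t k *\<^sub>R (x k - a)) \<longlonglongrightarrow> d"
  shows "(\<lambda>k. t k * (f (x k) - f a)) \<longlonglongrightarrow> D \<bullet> d"
  using has_derivative_scaled_sequence[of f "\<lambda>h. h \<bullet> D" a UNIV x t d] assms
  by (simp add: gderiv_def inner_commute)

text \<open>
  The sampling times are reciprocals of the scalings, so that the times themselves form a
  scaled sequence with limit direction \<open>1\<close>.
\<close>

lemma right_derivative_in_tangent_cone:
  fixes \<xi> :: "real \<Rightarrow> 'a::real_normed_vector"
  assumes deriv: "(\<xi> has_vector_derivative d) (at_right 0)"
    and "\<delta> > 0"
    and feas: "\<And>t. t \<in> {0..<\<delta>} \<Longrightarrow> \<xi> t \<in> F"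
  shows "d \<in> tangent_cone F (\<xi> 0)"
proof -
  \<comment> \<open>The shift by \<open>2\<close> keeps every sampling time strictly below \<open>\<delta>\<close>.\<close>
  define t where "t k = (real k + 2) / \<delta>" for k
  define s where "s k = inverse (t k)" for k
  have t_pos: "t k > 0" for k
    using \<open>\<delta> > 0\<close> by (simp add: t_def)
  have s_in: "0 < s k" "s k < \<delta>" for k
    using \<open>\<delta> > 0\<close> by (simp_all add: s_def t_def divide_less_eq)
  have "filterlim t at_top sequentially"
    unfolding t_def using \<open>\<delta> > 0\<close> by real_asymp
  then have s_lim: "s \<longlonglongrightarrow> 0"
    unfolding s_def by (rule tendsto_inverse_0_at_top)
  have "t k *\<^sub>R (s k - 0) = 1" for k
    using t_pos[of k] by (simp add: s_def)
  then have "(\<lambda>k. t k *\<^sub>R (s k - 0)) \<longlonglongrightarrow> 1"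
    by simp
  then have "(\<lambda>k. t k *\<^sub>R (\<xi> (s k) - \<xi> 0)) \<longlonglongrightarrow> 1 *\<^sub>R d"
    using deriv s_in s_lim unfolding has_vector_derivative_def
    by (intro has_derivative_scaled_sequence[where f' = "\<lambda>h. h *\<^sub>R d" and S = "{0<..}"]) simp_all
  moreover have "(\<lambda>k. \<xi> (s k)) \<longlonglongrightarrow> \<xi> 0"
    using has_vector_derivative_continuous[OF deriv]
    by (rule continuous_within_tendsto_compose) (use s_in s_lim in auto)
  moreover have "t k \<ge> 0" "\<xi> (s k) \<in> F" for k
    using t_pos[of k] s_in[of k] feas[of "s k"] by simp_all
  ultimately show ?thesis
    unfolding tangent_cone_def by (auto intro!: exI[of _ t] exI[of _ "\<lambda>k. \<xi> (s k)"])
qed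

lemma zero_in_tangent_cone:
  assumes "a \<in> F"
  shows "0 \<in> tangent_cone F a"
  unfolding tangent_cone_def
  using assms by (auto intro!: exI[of _ "\<lambda>_. 0"] exI[of _ "\<lambda>_. a"])

text \<open>
  Feasibility of \<open>x k\<close> and of \<open>xbar\<close> determines the sign of each scaled difference quotient, and signs
  survive in the limit.  The product rule for \<open>G H\<close> covers \<open>I_G\<close> and \<open>I_H\<close> at once; on \<open>I_GH\<close>
  it degenerates to \<open>0 = 0\<close>, and the two quotients have to be multiplied before taking limits.
\<close>

lemma tangent_cone_subset_mpsc_linearization_cone:
  fixes P :: "'n::finite mpsc" and xbar :: "real ^ 'n"
  assumes C2: "C2_mpsc P"
    and feas: "xbar \<in> feasible_set P"
  shows "tangent_cone (feasible_set P) xbar \<subseteq> mpsc_linearization_cone P xbar"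
proof
  fix d assume "d \<in> tangent_cone (feasible_set P) xbar"
  then obtain t x where t: "\<And>k. t k \<ge> (0::real)" and x: "\<And>k. x k \<in> feasible_set P"
    and lims: "x \<longlonglongrightarrow> xbar" "(\<lambda>k. t k *\<^sub>R (x k - xbar)) \<longlonglongrightarrow> d"
    unfolding tangent_cone_def by auto
  have quot: "(\<lambda>k. t k * (f (x k) - f xbar)) \<longlonglongrightarrow> gradient f xbar \<bullet> d" if "C2_function f" for f
    using GDERIV_scaled_sequence[OF C2_function_GDERIV_gradient[OF that] lims] .
  have ineq: "gradient (ineq_con P i) xbar \<bullet> d \<le> 0" if i: "i \<in> I_g P xbar" for i
  proof (rule LIMSEQ_le_const2)
    show "(\<lambda>k. t k * (ineq_con P i (x k) - ineq_con P i xbar))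
        \<longlonglongrightarrow> gradient (ineq_con P i) xbar \<bullet> d"
      using C2 i by (intro quot) (auto simp: C2_mpsc_def I_g_def)
    show "\<exists>N. \<forall>k\<ge>N. t k * (ineq_con P i (x k) - ineq_con P i xbar) \<le> 0"
      using i t x by (auto simp: I_g_def feasible_set_def intro!: mult_nonneg_nonpos)
  qed
  have eq: "gradient (eq_con P j) xbar \<bullet> d = 0" if j: "j \<in> I_h P" for j
  proof -
    have "(\<lambda>k. t k * (eq_con P j (x k) - eq_con P j xbar)) \<longlonglongrightarrow> gradient (eq_con P j) xbar \<bullet> d"
      using C2 j by (intro quot) (auto simp: C2_mpsc_def I_h_def)
    moreover have "t k * (eq_con P j (x k) - eq_con P j xbar) = 0" for k
      using j x[of k] feas by (auto simp: I_h_def feasible_set_def)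
    ultimately show ?thesis
      by (simp add: LIMSEQ_const_iff)
  qed
  have C2_switch: "C2_function (switch_G P k)" "C2_function (switch_H P k)"
    if "k \<in> {1..num_switch P}" for k
    using C2 that by (auto simp: C2_mpsc_def)
  have switch_feas: "switch_G P k y * switch_H P k y = 0"
    if "k \<in> {1..num_switch P}" "y \<in> feasible_set P" for k y
    using that by (auto simp: feasible_set_def)
  \<comment> \<open>Product rule for the switching constraint, read as the equality constraint \<open>G H = 0\<close>.\<close>
  have prod_rule: "switch_G P k xbar * (gradient (switch_H P k) xbar \<bullet> d) +
      switch_H P k xbar * (gradient (switch_G P k) xbar \<bullet> d) = 0"
    if k: "k \<in> {1..num_switch P}" for k
  proof -
    let ?D = "switch_G P k xbar *\<^sub>R gradient (switch_H P k) xbar +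
              switch_H P k xbar *\<^sub>R gradient (switch_G P k) xbar"
    let ?GH = "\<lambda>y. switch_G P k y * switch_H P k y"
    have "GDERIV ?GH xbar :> ?D"
      using C2_switch[OF k] by (intro GDERIV_mult C2_function_GDERIV_gradient)
    then have "(\<lambda>n. t n * (?GH (x n) - ?GH xbar)) \<longlonglongrightarrow> ?D \<bullet> d"
      using lims by (rule GDERIV_scaled_sequence)
    then have "?D \<bullet> d = 0"
      using switch_feas[OF k x] switch_feas[OF k feas] by (simp add: LIMSEQ_const_iff)
    then show ?thesis
      by (simp add: inner_add_left)
  qed
  have biactive: "(gradient (switch_G P k) xbar \<bullet> d) * (gradient (switch_H P k) xbar \<bullet> d) = 0"
    if k: "k \<in> I_GH P xbar" for k
  proof -
    have k': "k \<in> {1..num_switch P}" "switch_G P k xbar = 0" "switch_H P k xbar = 0"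
      using k by (auto simp: I_GH_def)
    have "(\<lambda>n. (t n * switch_G P k (x n)) * (t n * switch_H P k (x n)))
        \<longlonglongrightarrow> (gradient (switch_G P k) xbar \<bullet> d) * (gradient (switch_H P k) xbar \<bullet> d)"
      using quot[OF C2_switch(1)[OF k'(1)]] quot[OF C2_switch(2)[OF k'(1)]] k'
      by (intro tendsto_mult) simp_all
    moreover have "(t n * switch_G P k (x n)) * (t n * switch_H P k (x n)) = 0" for n
      using switch_feas[OF k'(1) x[of n]] by auto
    ultimately show ?thesis
      by (simp only: LIMSEQ_const_iff)
  qed
  have "gradient (switch_G P k) xbar \<bullet> d = 0" if "k \<in> I_G P xbar" for k
    using prod_rule[of k] that by (auto simp: I_G_def)
  moreover have "gradient (switch_H P k) xbar \<bullet> d = 0" if "k \<in> I_H P xbar" for k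
    using prod_rule[of k] that by (auto simp: I_H_def)
  ultimately show "d \<in> mpsc_linearization_cone P xbar"
    using ineq eq biactive by (auto simp: mpsc_linearization_cone_def)
qed

text \<open>
  Nonzero directions are initial velocities of feasible arcs.  The constraint qualification
  supplies no arc for the zero direction, which is tangent because \<open>xbar\<close> is feasible.
\<close>

lemma MPSC_SSOCQ_linearization_cone_subset_tangent_cone:
  fixes P :: "'n::finite mpsc" and xbar :: "real ^ 'n"
  assumes feas: "xbar \<in> feasible_set P"
    and SSOCQ: "MPSC_SSOCQ P xbar"
  shows "mpsc_linearization_cone P xbar \<subseteq> tangent_cone (feasible_set P) xbar"
proof
  fix d assume d: "d \<in> mpsc_linearization_cone P xbar"
  show "d \<in> tangent_cone (feasible_set P) xbar"
  proof (cases "d = 0")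
    case True
    then show ?thesis
      using zero_in_tangent_cone[OF feas] by simp
  next
    case False
    obtain \<delta> \<xi> where "\<delta> > 0" "\<forall>t\<in>{0..<\<delta>}. \<xi> t \<in> feasible_set P" "\<xi> 0 = xbar"
      "(\<xi> has_vector_derivative d) (at_right 0)"
      using SSOCQ[unfolded MPSC_SSOCQ_def, rule_format, OF d False] by blast
    then show ?thesis
      using right_derivative_in_tangent_cone[of \<xi> d \<delta> "feasible_set P"] by auto
  qed
qed

theorem lemma3p2:
  fixes P :: "'n::finite mpsc" and xbar :: "real ^ 'n"
  assumes "C2_mpsc P"
    and "xbar \<in> feasible_set P"
    and "MPSC_SSOCQ P xbar"
  shows "MPSC_ACQ P xbar"
  unfolding MPSC_ACQ_def
  using MPSC_SSOCQ_linearization_cone_subset_tangent_cone[OF assms(2,3)]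
    tangent_cone_subset_mpsc_linearization_cone[OF assms(1,2)]
  by (rule equalityI)

end
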